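(* For every finite simple graph $G=(V,E)$ on $n\ge 1$ vertices, every function $\ell:V\to\{0,1\}$ and every $x\in\mathbb{R}$, we have $$M_{\ell,x}(G)=2^{-n}\sum_{R\subseteq V}x^{|R|}(2+x)^{z_\ell(R)}(2-x)^{n-z_\ell(R)-|R|},$$ with the convention $0^0=1$.
   Context: For $S\subseteq V$ and $v\in V$ write $d_S(v):=|N_G(v)\cap S|$, where $N_G(v)$ is the set of neighbours of $v$ in $G$. Given $\ell:V\to\{0,1\}$, a set $S\subseteq V$ is called $\ell$-admissible if $d_S(v)\equiv \ell(v)\pmod 2$ for every $v\in S$; the empty set is regarded as $\ell$-admissible. Let $\mathcal{A}_\ell(G)$ be the collection of all $\ell$-admissible sets $S\subseteq V$. For $x\in\mathbb{R}$ define $$M_{\ell,x}(G):=\sum_{S\in\mathcal{A}_\ell(G)}x^{|S|}.$$ For $R\subseteq V$ define $$z_\ell(R):=\bigl|\{v\in V\setminus R: d_R(v)\equiv\ell(v)\pmod 2\}\bigr|.$$ *)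

theory Defs
  imports Complex_Main "HOL-Number_Theory.Cong" "Graph_Theory.Digraph"
begin

(* A finite simple graph is the locale predicate graph of Graph_Theory: a finite, loop-free
   digraph without parallel arcs whose adjacency relation arcs_ends is symmetric. An undirected
   edge is thus a pair of opposite arcs. *)

definition nbhd :: "('a, 'b) pre_digraph \<Rightarrow> 'a \<Rightarrow> 'a set" where
  "nbhd G v = {u \<in> verts G. v \<rightarrow>\<^bsub>G\<^esub> u}"

definition deg_in :: "('a, 'b) pre_digraph \<Rightarrow> 'a set \<Rightarrow> 'a \<Rightarrow> nat" where
  "deg_in G S v = card (nbhd G v \<inter> S)"

(* The labelling is a total function on the vertex type; only its values on verts G matter. *)

definition admissible :: "('a, 'b) pre_digraph \<Rightarrow> ('a \<Rightarrow> nat) \<Rightarrow> 'a set \<Rightarrow> bool" where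
  "admissible G l S \<longleftrightarrow> S \<subseteq> verts G \<and> (\<forall>v\<in>S. [deg_in G S v = l v] (mod 2))"

definition admissible_sets :: "('a, 'b) pre_digraph \<Rightarrow> ('a \<Rightarrow> nat) \<Rightarrow> 'a set set" where
  "admissible_sets G l = {S. admissible G l S}"

definition M_poly :: "('a, 'b) pre_digraph \<Rightarrow> ('a \<Rightarrow> nat) \<Rightarrow> real \<Rightarrow> real" where
  "M_poly G l x = (\<Sum>S\<in>admissible_sets G l. x ^ card S)"

definition z_count :: "('a, 'b) pre_digraph \<Rightarrow> ('a \<Rightarrow> nat) \<Rightarrow> 'a set \<Rightarrow> nat" where
  "z_count G l R = card {v \<in> verts G - R. [deg_in G R v = l v] (mod 2)}"

end

theory Submission
  imports Defs
begin

text \<open>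
  Let \<open>s R v\<close> denote the sign \<open>(-1) ^ (deg_in G R v + l v)\<close>, which is
  \<open>1\<close> if \<open>deg_in G R v\<close> has the prescribed parity and \<open>-1\<close> otherwise. The summand for \<open>R\<close> on
  the right is then \<open>x ^ card R\<close> times the product of \<open>2 + s R v * x\<close> over the vertices \<open>v\<close>
  outside \<open>R\<close>, and expanding it gives a sum over the sets \<open>T\<close> disjoint from \<open>R\<close>. Expanding the
  indicator of admissibility of \<open>S\<close>, the product of \<open>(1 + s S v) / 2\<close> over \<open>v \<in> S\<close>, gives a sum
  over the sets \<open>T \<subseteq> S\<close>.

  The two double sums agree term by term under \<open>S = R \<union> T\<close>: one carries the sign given by the
  product of \<open>s R v\<close> over \<open>v \<in> T\<close>, the other that of \<open>s (R \<union> T) v\<close>, and the exponents differ by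
  the degree sum of the graph induced on \<open>T\<close>, which is even by the handshake lemma.
\<close>

text \<open>
  The handshake lemma, by adding the vertices of \<open>T\<close> one at a time: a new vertex contributes its
  own degree, and, by symmetry of adjacency, the same number again to the degrees of the others.
\<close>

lemma (in graph) even_sum_deg_in:
  assumes "T \<subseteq> verts G"
  shows "even (\<Sum>v\<in>T. deg_in G T v)"
proof -
  have "finite T"
    using assms finite_verts by (rule finite_subset)
  then show ?thesis
    using assms
  proof (induction T rule: finite_induct)
    case empty
    then show ?case by simp
  next
    case (insert a T)
    have loop: "a \<notin> nbhd G a"
      using adj_not_same by (auto simp: nbhd_def)
    have deg_insert: "deg_in G (insert a T) v = deg_in G T v + of_bool (v \<in> nbhd G a)"
      if "v \<in> T" for v
    proof -
      have "a \<in> nbhd G v \<longleftrightarrow> v \<in> nbhd G a"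
        using that insert.prems arcs_ends_symmetric[OF sym_arcs] unfolding nbhd_def by blast
      then show ?thesis
        using insert.hyps by (auto simp: deg_in_def Int_insert_right)
    qed
    have "(\<Sum>v\<in>T. of_bool (v \<in> nbhd G a) :: nat) = card (T \<inter> nbhd G a)"
      using insert.hyps by (simp add: of_bool_def sum.If_cases Collect_mem_eq)
    then have "(\<Sum>v\<in>T. of_bool (v \<in> nbhd G a)) = deg_in G T a"
      by (simp add: deg_in_def Int_commute)
    then have sum_T: "(\<Sum>v\<in>T. deg_in G (insert a T) v) = (\<Sum>v\<in>T. deg_in G T v) + deg_in G T a"
      by (simp add: deg_insert sum.distrib)
    have "deg_in G (insert a T) a = deg_in G T a"
      using loop by (simp add: deg_in_def)
    then have "(\<Sum>v\<in>insert a T. deg_in G (insert a T) v) = (\<Sum>v\<in>T. deg_in G T v) + 2 * deg_in G T a"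
      using insert.hyps sum_T by simp
    then show ?case
      using insert.IH insert.prems by simp
  qed
qed

definition parity_sign :: "('a, 'b) pre_digraph \<Rightarrow> ('a \<Rightarrow> nat) \<Rightarrow> 'a set \<Rightarrow> 'a \<Rightarrow> real" where
  "parity_sign G l R v = (-1) ^ (deg_in G R v + l v)"

lemma parity_sign_eq:
  "parity_sign G l R v = (if [deg_in G R v = l v] (mod 2) then 1 else -1)"
proof -
  have "[deg_in G R v = l v] (mod 2) \<longleftrightarrow> even (deg_in G R v + l v)"
    unfolding cong_def by presburger
  then show ?thesis
    by (simp add: parity_sign_def)
qed

text \<open>
  Adjoining \<open>T\<close> to the disjoint set \<open>R\<close> raises the sum of the degrees of the vertices of \<open>T\<close> by
  the degree sum of the graph induced on \<open>T\<close>, which is even. This is what makes the two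
  expansions comparable: the sign may be computed from \<open>R\<close> instead of \<open>R \<union> T\<close>.
\<close>

lemma (in graph) prod_parity_sign_union:
  assumes "R \<subseteq> verts G" "T \<subseteq> verts G" "R \<inter> T = {}"
  shows "(\<Prod>v\<in>T. parity_sign G l (R \<union> T) v) = (\<Prod>v\<in>T. parity_sign G l R v)"
proof -
  have "finite R" "finite T"
    using assms finite_subset[OF _ finite_verts] by auto
  then have deg_union: "deg_in G (R \<union> T) v = deg_in G R v + deg_in G T v" for v
    using assms(3) unfolding deg_in_def Int_Un_distrib by (subst card_Un_disjoint) auto
  have "(\<Prod>v\<in>T. parity_sign G l (R \<union> T) v)
      = (\<Prod>v\<in>T. parity_sign G l R v * (-1) ^ deg_in G T v)"
    by (intro prod.cong refl) (simp add: parity_sign_def deg_union power_add)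
  also have "\<dots> = (\<Prod>v\<in>T. parity_sign G l R v) * (-1) ^ (\<Sum>v\<in>T. deg_in G T v)"
    by (simp add: prod.distrib power_sum)
  finally show ?thesis
    using even_sum_deg_in[OF assms(2)] by simp
qed

lemma prod_const_add_eq_sum_Pow:
  fixes f :: "'a \<Rightarrow> 'b::comm_semiring_1"
  assumes "finite A"
  shows "(\<Prod>v\<in>A. c + f v) = (\<Sum>T\<in>Pow A. c ^ card (A - T) * (\<Prod>v\<in>T. f v))"
  using prod_add[OF assms, of f "\<lambda>_. c"] by (simp add: add.commute mult.commute)

lemma admissible_indicator_eq_sum:
  assumes "finite S" "S \<subseteq> verts G"
  shows "of_bool (admissible G l S) =
      (1 / 2) ^ card S * (\<Sum>T\<in>Pow S. \<Prod>v\<in>T. parity_sign G l S v)"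
proof -
  have "(\<Sum>T\<in>Pow S. \<Prod>v\<in>T. parity_sign G l S v) = (\<Prod>v\<in>S. 1 + parity_sign G l S v)"
    using prod_const_add_eq_sum_Pow[OF assms(1), of "1::real"] by simp
  also have "\<dots> = (\<Prod>v\<in>S. 2 * of_bool [deg_in G S v = l v] (mod 2))"
    by (rule prod.cong) (simp_all add: parity_sign_eq)
  also have "\<dots> = 2 ^ card S * of_bool (admissible G l S)"
    using assms by (auto simp: admissible_def prod.distrib prod_zero_iff)
  finally show ?thesis
    by (simp add: power_divide)
qed

text \<open>
  Each of the \<open>card (verts G) - card R\<close> vertices outside \<open>R\<close> is counted in exactly one of the two
  exponents, so the truncated subtraction loses nothing and the weight factors over vertices.
\<close>

lemma weight_eq_prod:
  fixes x :: real
  assumes "finite (verts G)" "R \<subseteq> verts G"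
  shows "(2 + x) ^ z_count G l R * (2 - x) ^ (card (verts G) - z_count G l R - card R)
      = (\<Prod>v\<in>verts G - R. 2 + parity_sign G l R v * x)"
proof -
  let ?A = "verts G - R"
  let ?P = "\<lambda>v. [deg_in G R v = l v] (mod 2)"
  have fin: "finite ?A" "finite R"
    using assms finite_subset by blast+
  have "card {v \<in> ?A. \<not> ?P v} + z_count G l R = card ?A"
    unfolding z_count_def using fin
    by (subst card_Un_disjoint[symmetric]) (auto intro!: arg_cong[of _ _ card])
  then have neg: "card {v \<in> ?A. \<not> ?P v} = card (verts G) - z_count G l R - card R"
    using fin assms by (simp add: card_Diff_subset)
  have "(\<Prod>v\<in>?A. 2 + parity_sign G l R v * x) = (\<Prod>v\<in>?A. if ?P v then 2 + x else 2 - x)"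
    by (rule prod.cong) (simp_all add: parity_sign_eq)
  also have "\<dots> = (2 + x) ^ card {v \<in> ?A. ?P v} * (2 - x) ^ card {v \<in> ?A. \<not> ?P v}"
    using fin by (simp add: prod.If_cases Int_def)
  finally show ?thesis
    by (simp only: z_count_def neg)
qed

lemma sum_disjoint_pairs:
  assumes "finite V"
  shows "(\<Sum>R\<in>Pow V. \<Sum>T\<in>Pow (V - R). F R T) = (\<Sum>S\<in>Pow V. \<Sum>T\<in>Pow S. F (S - T) T)"
proof -
  have fin: "finite S" if "S \<subseteq> V" for S
    using assms that finite_subset by blast
  have "(\<Sum>R\<in>Pow V. \<Sum>T\<in>Pow (V - R). F R T)
      = (\<Sum>(R, T)\<in>(SIGMA R:Pow V. Pow (V - R)). F R T)"
    using assms by (subst sum.Sigma) auto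
  also have "\<dots> = (\<Sum>(S, T)\<in>(SIGMA S:Pow V. Pow S). F (S - T) T)"
    by (rule sum.reindex_bij_witness
          [where i = "\<lambda>(S, T). (S - T, T)" and j = "\<lambda>(R, T). (R \<union> T, T)"])
       (auto intro!: arg_cong2[of _ _ _ _ F])
  also have "\<dots> = (\<Sum>S\<in>Pow V. \<Sum>T\<in>Pow S. F (S - T) T)"
    using assms fin by (subst sum.Sigma) auto
  finally show ?thesis .
qed

theorem theorem2p1:
  fixes G :: "('a, 'b) pre_digraph" and l :: "'a \<Rightarrow> nat" and x :: real and n :: nat
  assumes "graph G"
    and "card (verts G) = n" and "n \<ge> 1"
    and "\<forall>v\<in>verts G. l v \<in> {0, 1}"
  shows "M_poly G l x =
    1 / 2 ^ n *
      (\<Sum>R\<in>Pow (verts G).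
        x ^ card R * (2 + x) ^ z_count G l R * (2 - x) ^ (n - z_count G l R - card R))"
proof -
  interpret graph G by fact
  let ?V = "verts G"
  let ?s = "parity_sign G l"
  have fin: "finite S" if "S \<subseteq> ?V" for S
    using that finite_verts by (rule finite_subset)
  \<comment> \<open>The contribution of \<open>T\<close> to the expansion of the summand for \<open>R\<close>.\<close>
  define F where "F R T = x ^ card R * (2 ^ card (?V - R - T) * (\<Prod>v\<in>T. ?s R v * x))" for R T
  have F_eq: "F (S - T) T = 2 ^ n * ((x / 2) ^ card S * (\<Prod>v\<in>T. ?s S v))"
    if "S \<subseteq> ?V" "T \<subseteq> S" for S T
  proof -
    have "T \<subseteq> ?V" "S - T \<subseteq> ?V" "S - T \<union> T = S" "?V - (S - T) - T = ?V - S"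
      using that by auto
    then have sign: "(\<Prod>v\<in>T. ?s S v) = (\<Prod>v\<in>T. ?s (S - T) v)"
      and rest: "card (?V - (S - T) - T) = n - card S"
      using prod_parity_sign_union[of "S - T" T l] card_Diff_subset[OF fin that(1)] that(1) assms(2)
      by auto
    have cards: "card (S - T) + card T = card S" "card S \<le> n"
      using card_Diff_subset[OF _ that(2)] card_mono[OF _ that(2)] card_mono[OF finite_verts that(1)]
        fin[OF that(1)] finite_subset[OF that(2)] assms(2)
      by auto
    have "F (S - T) T = x ^ (card (S - T) + card T) * 2 ^ (n - card S) * (\<Prod>v\<in>T. ?s S v)"
      unfolding F_def rest sign by (simp add: prod.distrib power_add)
    also have "\<dots> = 2 ^ n * ((x / 2) ^ card S * (\<Prod>v\<in>T. ?s S v))"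
      using cards by (simp add: power_diff power_divide)
    finally show ?thesis .
  qed
  have "(\<Sum>R\<in>Pow ?V. x ^ card R * (2 + x) ^ z_count G l R * (2 - x) ^ (n - z_count G l R - card R))
      = (\<Sum>R\<in>Pow ?V. \<Sum>T\<in>Pow (?V - R). F R T)"
  proof (rule sum.cong)
    fix R assume "R \<in> Pow ?V"
    then show "x ^ card R * (2 + x) ^ z_count G l R * (2 - x) ^ (n - z_count G l R - card R)
        = (\<Sum>T\<in>Pow (?V - R). F R T)"
      using weight_eq_prod[of G R x l] assms(2)
      by (simp add: F_def prod_const_add_eq_sum_Pow sum_distrib_left mult.assoc)
  qed simp
  also have "\<dots> = (\<Sum>S\<in>Pow ?V. \<Sum>T\<in>Pow S. F (S - T) T)"
    by (rule sum_disjoint_pairs) simp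
  also have "\<dots> = (\<Sum>S\<in>Pow ?V. 2 ^ n * (x ^ card S * of_bool (admissible G l S)))"
  proof (rule sum.cong)
    fix S assume "S \<in> Pow ?V"
    then show "(\<Sum>T\<in>Pow S. F (S - T) T) = 2 ^ n * (x ^ card S * of_bool (admissible G l S))"
      using fin by (simp add: F_eq admissible_indicator_eq_sum sum_distrib_left power_divide)
  qed simp
  also have "\<dots> = 2 ^ n * (\<Sum>S\<in>Pow ?V. x ^ card S * of_bool (admissible G l S))"
    by (simp only: sum_distrib_left)
  also have "(\<Sum>S\<in>Pow ?V. x ^ card S * of_bool (admissible G l S)) = M_poly G l x"
    unfolding M_poly_def
    by (rule sum.mono_neutral_cong_right) (auto simp: admissible_sets_def admissible_def)
  finally show ?thesis
    by simp
qed

end
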